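(* Consider the cumulative logit model with partial proportional odds: $\log\left(\frac{\pi_{i1}+\cdots+\pi_{ij}}{\pi_{i,j+1}+\cdots+\pi_{iJ}}\right)=\mathbf h_j^T(\mathbf x_i)\boldsymbol\beta_j+\mathbf h_c^T(\mathbf x_i)\boldsymbol\zeta$ for $i=1,\dots,m$, $j=1,\dots,J-1$. Suppose $\mathbf h_j(\mathbf x_i)=\mathbf h_{J-j}(\mathbf x_i)$ for all $i=1,\dots,m$ and $j=1,\dots,J-1$. Then any order $\sigma_1$ (a permutation of $\{1,\dots,J\}$) is equivalent to its reverse order $\sigma_2$, which satisfies $\sigma_2(j)=\sigma_1(J+1-j)$ for $j=1,\dots,J$; that is, $\sigma_1\sim\sigma_2$.
   Context: Data. There are $d\ge1$ covariates and $J\ge3$ response categories. The data are $\{(\mathbf x_i,\mathbf Y_i): i=1,\dots,m\}$, where $\mathbf x_1,\dots,\mathbf x_m$ are distinct level combinations of the $d$ covariates and $\mathbf Y_i=(Y_{i1},\dots,Y_{iJ})^T$, with $Y_{ij}$ the number of observations with covariates $\mathbf x_i$ in the $j$th response category, $n_i=\sum_{j=1}^JY_{ij}>0$. It is assumed that $\mathbf Y_i\sim\mathrm{Multinomial}(n_i;\pi_{i1},\dots,\pi_{iJ})$ independently over $i$, with $\pi_{ij}>0$ and $\sum_{j=1}^J\pi_{ij}=1$. Model. $\mathbf h_j$ (with $p_j$ components, $j=1,\dots,J-1$) and $\mathbf h_c$ (with $p_c$ components) are known vector-valued predictor functions, and the unknown parameter is $\boldsymbol\theta=(\boldsymbol\beta_1^T,\dots,\boldsymbol\beta_{J-1}^T,\boldsymbol\zeta^T)^T\in\mathbb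 R^p$ with $\boldsymbol\beta_j\in\mathbb R^{p_j}$, $\boldsymbol\zeta\in\mathbb R^{p_c}$, $p=p_1+\cdots+p_{J-1}+p_c$. The parameter space (the set of all feasible $\boldsymbol\theta$) is $\boldsymbol\Theta=\{\boldsymbol\theta\in\mathbb R^p:\mathbf h_j^T(\mathbf x_i)\boldsymbol\beta_j<\mathbf h_{j+1}^T(\mathbf x_i)\boldsymbol\beta_{j+1},\ j=1,\dots,J-2,\ i=1,\dots,m\}$. For $\boldsymbol\theta\in\boldsymbol\Theta$, $\pi_{i1}(\boldsymbol\theta),\dots,\pi_{iJ}(\boldsymbol\theta)$ are the category probabilities determined by the model equations at $\mathbf x_i$. Orders and equivalence. An order is a permutation $\sigma$ of $\{1,\dots,J\}$. Using the model with order $\sigma$ means fitting it to the permuted data $\{(\mathbf x_i,\mathbf Y_i^\sigma)\}$, $\mathbf Y_i^\sigma=(Y_{i\sigma(1)},\dots,Y_{i\sigma(J)})^T$. For $k=1,2$ let $l_k(\boldsymbol\theta)$ be the likelihood function with order $\sigma_k$, i.e. (on the log scale) $$\sum_{i=1}^m\log(n_i!)-\sum_{i=1}^m\sum_{j=1}^J\log(Y_{i\sigma_k(j)}!)+\sum_{i=1}^m\sum_{j=1}^JY_{i\sigma_k(j)}\log\pi_{ij}(\boldsymbol\theta).$$ Two orders are equivalent, $\sigma_1\sim\sigma_2$, if $\max_{\boldsymbol\theta\in\boldsymbol\Theta}l_1(\boldsymbol\theta)=\max_{\boldsymbol\theta\in\boldsymbol\Theta}l_2(\boldsymbol\theta)$.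 *)

theory Defs
  imports
    "HOL-Library.FuncSet"
    "HOL-Library.Extended_Real"
    "HOL-Combinatorics.Permutations"
    "Jordan_Normal_Form.Matrix"
begin

text \<open>
  Observations, categories and predictor functions are numbered from 1: \<open>i \<in> {1..m}\<close>,
  \<open>j \<in> {1..J}\<close> for categories, \<open>j \<in> {1..J - 1}\<close> for the predictors \<open>h j\<close>. Vectors are
  of type \<open>real vec\<close>, whose entries are numbered from 0. The parameter \<open>\<theta>\<close> is one vector, the
  concatenation of the blocks \<open>\<beta> 1, \<dots>, \<beta> (J - 1), \<zeta>\<close> of dimensions \<open>p 1, \<dots>, p (J - 1), pc\<close>.
\<close>

definition param_dim :: "nat \<Rightarrow> (nat \<Rightarrow> nat) \<Rightarrow> nat \<Rightarrow> nat" where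
  "param_dim J p pc = (\<Sum>j = 1..J - 1. p j) + pc"

definition beta_block :: "(nat \<Rightarrow> nat) \<Rightarrow> nat \<Rightarrow> real vec \<Rightarrow> real vec" where
  "beta_block p j \<theta> = vec (p j) (\<lambda>k. \<theta> $ ((\<Sum>l = 1..<j. p l) + k))"

definition zeta_block :: "nat \<Rightarrow> (nat \<Rightarrow> nat) \<Rightarrow> nat \<Rightarrow> real vec \<Rightarrow> real vec" where
  "zeta_block J p pc \<theta> = vec pc (\<lambda>k. \<theta> $ ((\<Sum>l = 1..J - 1. p l) + k))"

definition param_space ::
  "nat \<Rightarrow> nat \<Rightarrow> (nat \<Rightarrow> real vec) \<Rightarrow> (nat \<Rightarrow> nat) \<Rightarrow> nat \<Rightarrow> (nat \<Rightarrow> real vec \<Rightarrow> real vec) \<Rightarrow>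
   real vec set" where
  "param_space J m x p pc h =
     {\<theta> \<in> carrier_vec (param_dim J p pc).
        \<forall>j\<in>{1..J - 2}. \<forall>i\<in>{1..m}.
          h j (x i) \<bullet> beta_block p j \<theta> < h (j + 1) (x i) \<bullet> beta_block p (j + 1) \<theta>}"

text \<open>The cumulative logit model with partial proportional odds at covariate value \<open>z\<close>.\<close>

definition cumulative_ppo_probs ::
  "nat \<Rightarrow> (nat \<Rightarrow> nat) \<Rightarrow> nat \<Rightarrow> (nat \<Rightarrow> real vec \<Rightarrow> real vec) \<Rightarrow> (real vec \<Rightarrow> real vec) \<Rightarrow>
   real vec \<Rightarrow> real vec \<Rightarrow> (nat \<Rightarrow> real) \<Rightarrow> bool" where
  "cumulative_ppo_probs J p pc h hc \<theta> z q \<longleftrightarrow>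
     (\<forall>j\<in>{1..J}. q j > 0) \<and> (\<Sum>j = 1..J. q j) = 1 \<and>
     (\<forall>j\<in>{1..J - 1}.
        ln ((\<Sum>k = 1..j. q k) / (\<Sum>k = j + 1..J. q k)) =
          h j z \<bullet> beta_block p j \<theta> + hc z \<bullet> zeta_block J p pc \<theta>)"

text \<open>
  The model equations determine the probabilities only on \<open>{1..J}\<close>; extensionality fixes the
  remaining values, so that the description is unique whenever \<open>\<theta>\<close> is feasible
  (see \<open>cumulative_ppo_probs_ex1\<close>).
\<close>

definition cat_prob ::
  "nat \<Rightarrow> (nat \<Rightarrow> nat) \<Rightarrow> nat \<Rightarrow> (nat \<Rightarrow> real vec \<Rightarrow> real vec) \<Rightarrow> (real vec \<Rightarrow> real vec) \<Rightarrow>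
   (nat \<Rightarrow> real vec) \<Rightarrow> real vec \<Rightarrow> nat \<Rightarrow> nat \<Rightarrow> real" where
  "cat_prob J p pc h hc x \<theta> i =
     (THE q. q \<in> extensional {1..J} \<and> cumulative_ppo_probs J p pc h hc \<theta> (x i) q)"

text \<open>The model equations are consistent and determine the probabilities at feasible \<open>\<theta>\<close>.\<close>

lemma cumulative_logit_ex1:
  fixes \<eta> :: "nat \<Rightarrow> real"
  assumes J: "J \<ge> 2" and inc: "\<And>j. j \<in> {1..J - 2} \<Longrightarrow> \<eta> j < \<eta> (j + 1)"
  shows "\<exists>!q. q \<in> extensional {1..J} \<and> (\<forall>j\<in>{1..J}. q j > 0) \<and> (\<Sum>j = 1..J. q j) = 1 \<and>
           (\<forall>j\<in>{1..J - 1}. ln ((\<Sum>k = 1..j. q k) / (\<Sum>k = j + 1..J. q k)) = \<eta> j)"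
    (is "\<exists>!q. ?P q")
proof -
  define g where "g t = exp t / (1 + exp t)" for t :: real
  have g01: "0 < g t" "g t < 1" for t
    by (simp_all add: g_def add_pos_pos)
  have g_mono: "g s < g t" if "s < t" for s t
  proof -
    have "0 < 1 + exp s" "0 < 1 + exp t"
      by (simp_all add: add_pos_pos)
    then show ?thesis
      using that by (simp add: g_def divide_simps algebra_simps)
  qed
  have g_ln: "ln (g t / (1 - g t)) = t" for t
  proof -
    have "1 + exp t \<noteq> 0"
      using exp_gt_zero[of t] by linarith
    then have "g t / (1 - g t) = exp t"
      by (simp add: g_def field_simps)
    then show ?thesis
      by simp
  qed
  have split: "(\<Sum>k = j + 1..J. q k) = (\<Sum>k = 1..J. q k) - (\<Sum>k = 1..j. q k)"
    if "j \<le> J" for j and q :: "nat \<Rightarrow> real"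
    using sum.ub_add_nat[of 1 j q "J - j"] that by simp
  define F where "F j = (if j = 0 then 0 else if j \<ge> J then 1 else g (\<eta> j))" for j
  define q0 where "q0 = restrict (\<lambda>j. F j - F (j - 1)) {1..J}"
  have F_sum: "(\<Sum>k = 1..j. q0 k) = F j" if "j \<le> J" for j
    using that
  proof (induction j)
    case 0
    then show ?case by (simp add: F_def)
  next
    case (Suc j)
    then show ?case by (simp add: q0_def)
  qed
  show ?thesis
  proof (rule ex1I[of _ q0])
    have "q0 j > 0" if j: "j \<in> {1..J}" for j
    proof -
      have "F (j - 1) < F j"
      proof (cases "j = 1 \<or> j = J")
        case True
        then show ?thesis using J j g01 by (auto simp: F_def)
      next
        case False
        then have "j - 1 \<in> {1..J - 2}" "j - 1 + 1 = j"
          using j by auto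
        then have "\<eta> (j - 1) < \<eta> j"
          using inc[of "j - 1"] by metis
        then show ?thesis using False j g_mono by (auto simp: F_def)
      qed
      then show ?thesis using j by (simp add: q0_def)
    qed
    moreover have "(\<Sum>j = 1..J. q0 j) = 1"
      using F_sum[of J] J by (simp add: F_def)
    moreover have "ln ((\<Sum>k = 1..j. q0 k) / (\<Sum>k = j + 1..J. q0 k)) = \<eta> j"
      if "j \<in> {1..J - 1}" for j
    proof -
      have "j \<le> J" "j \<noteq> 0" "\<not> J \<le> j" using that J by auto
      then show ?thesis
        using split[of j q0] F_sum[of j] F_sum[of J] J g_ln[of "\<eta> j"] by (simp add: F_def)
    qed
    ultimately show "?P q0"
      by (simp add: q0_def)
  next
    fix q assume q: "?P q"
    define S where "S j = (\<Sum>k = 1..j. q k)" for j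
    have S_eq: "S j = F j" if j: "j \<le> J" for j
    proof (cases "j = 0 \<or> j = J")
      case True
      then show ?thesis using q J by (auto simp: S_def F_def)
    next
      case False
      then have jJ: "j \<in> {1..J - 1}" using j by auto
      have pos: "0 < S j" "0 < (\<Sum>k = j + 1..J. q k)"
        unfolding S_def using q jJ by (auto intro!: sum_pos)
      moreover have c: "(\<Sum>k = j + 1..J. q k) = 1 - S j"
        using split[of j q] j q by (simp add: S_def)
      moreover have "ln (S j / (\<Sum>k = j + 1..J. q k)) = \<eta> j"
        using q jJ unfolding S_def by blast
      ultimately have "S j / (1 - S j) = exp (\<eta> j)" "0 < 1 - S j"
        by (metis divide_pos_pos exp_ln, simp)
      then have "S j = exp (\<eta> j) * (1 - S j)"
        by (simp add: field_simps)
      then have "S j * (1 + exp (\<eta> j)) = exp (\<eta> j)"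
        by (simp add: algebra_simps)
      moreover have "1 + exp (\<eta> j) \<noteq> 0"
        using exp_gt_zero[of "\<eta> j"] by linarith
      ultimately have "S j = g (\<eta> j)"
        by (simp add: g_def eq_divide_eq)
      then show ?thesis using False j by (simp add: F_def)
    qed
    show "q = q0"
    proof (rule extensionalityI[of _ "{1..J}"])
      fix j assume j: "j \<in> {1..J}"
      then obtain i where i: "j = Suc i" by (cases j) auto
      have "q j = S j - S (j - 1)" by (simp add: S_def i)
      then show "q j = q0 j" using S_eq[of j] S_eq[of i] j by (simp add: q0_def i)
    qed (use q in \<open>auto simp: q0_def\<close>)
  qed
qed

lemma cumulative_ppo_probs_ex1:
  assumes "J \<ge> 2" and \<theta>: "\<theta> \<in> param_space J m x p pc h" and i: "i \<in> {1..m}"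
  shows "\<exists>!q. q \<in> extensional {1..J} \<and> cumulative_ppo_probs J p pc h hc \<theta> (x i) q"
  unfolding cumulative_ppo_probs_def
  by (rule cumulative_logit_ex1) (use assms in \<open>auto simp: param_space_def\<close>)

text \<open>
  The multinomial log-likelihood with order \<open>\<sigma>\<close>, for any family \<open>prob \<theta> i j\<close> of category
  probabilities.
\<close>

definition log_lik ::
  "nat \<Rightarrow> nat \<Rightarrow> (nat \<Rightarrow> nat \<Rightarrow> nat) \<Rightarrow> ('t \<Rightarrow> nat \<Rightarrow> nat \<Rightarrow> real) \<Rightarrow> (nat \<Rightarrow> nat) \<Rightarrow> 't \<Rightarrow> real" where
  "log_lik J m Y prob \<sigma> \<theta> =
     (\<Sum>i = 1..m. ln (fact (\<Sum>j = 1..J. Y i j)))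
     - (\<Sum>i = 1..m. \<Sum>j = 1..J. ln (fact (Y i (\<sigma> j))))
     + (\<Sum>i = 1..m. \<Sum>j = 1..J. real (Y i (\<sigma> j)) * ln (prob \<theta> i j))"

text \<open>
  The likelihood need not attain its supremum on the open set of feasible parameters. Equality of
  the maxima is therefore read as equality of the suprema in the extended reals, one of them being
  attained if and only if the other is.
\<close>

definition same_max :: "'t set \<Rightarrow> ('t \<Rightarrow> real) \<Rightarrow> ('t \<Rightarrow> real) \<Rightarrow> bool" where
  "same_max S f g \<longleftrightarrow>
     (SUP \<theta>\<in>S. ereal (f \<theta>)) = (SUP \<theta>\<in>S. ereal (g \<theta>)) \<and>
     ((\<exists>\<theta>. is_arg_max f (\<lambda>\<theta>. \<theta> \<in> S) \<theta>) \<longleftrightarrow> (\<exists>\<theta>. is_arg_max g (\<lambda>\<theta>. \<theta> \<in> S) \<theta>))"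

definition equivalent_orders ::
  "nat \<Rightarrow> nat \<Rightarrow> (nat \<Rightarrow> nat \<Rightarrow> nat) \<Rightarrow> 't set \<Rightarrow> ('t \<Rightarrow> nat \<Rightarrow> nat \<Rightarrow> real) \<Rightarrow>
   (nat \<Rightarrow> nat) \<Rightarrow> (nat \<Rightarrow> nat) \<Rightarrow> bool" where
  "equivalent_orders J m Y \<Theta> prob \<sigma>\<^sub>1 \<sigma>\<^sub>2 \<longleftrightarrow>
     same_max \<Theta> (log_lik J m Y prob \<sigma>\<^sub>1) (log_lik J m Y prob \<sigma>\<^sub>2)"

end

theory Submission
  imports Defs
begin

text \<open>
  Negating the parameter and reversing its blocks, \<open>\<beta>' j = - \<beta> (J - j)\<close> and \<open>\<zeta>' = - \<zeta>\<close>, negates the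
  cumulative logits and reverses their order, because \<open>h j = h (J - j)\<close> at the observed covariates.
  This preserves feasibility and reverses the category probabilities, so the log-likelihoods for an
  order and its reverse take the same values on the parameter space. If there are no observations,
  the dimensions \<open>p j\<close> and \<open>p (J - j)\<close> may differ, but then both log-likelihoods vanish.
\<close>

text \<open>The supremum and the existence of a maximiser depend only on the set of values taken on
  \<open>S\<close>. So it suffices to match values; no bijection between parameters has to be
  exhibited.\<close>

lemma same_max_if_image_eq:
  assumes "f ` S = g ` S"
  shows "same_max S f g"
proof -
  have arg_max: "(\<exists>\<theta>. is_arg_max k (\<lambda>\<theta>. \<theta> \<in> S) \<theta>) \<longleftrightarrow> (\<exists>v\<in>k ` S. \<forall>w\<in>k ` S. \<not> v < w)"
    for k :: "'a \<Rightarrow> real"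
    by (auto simp: is_arg_max_def)
  have "(\<lambda>\<theta>. ereal (f \<theta>)) ` S = (\<lambda>\<theta>. ereal (g \<theta>)) ` S"
    using assms by (metis image_image)
  then show ?thesis
    unfolding same_max_def arg_max assms by simp
qed

text \<open>Keeps every index read by block \<open>j\<close> inside the first \<open>n\<close>
  blocks, so appending a vector after them cannot change that block.\<close>

lemma sum_block_le_sum:
  fixes p :: "nat \<Rightarrow> nat"
  assumes "j \<in> {1..n}"
  shows "(\<Sum>l = 1..<j. p l) + p j \<le> (\<Sum>l = 1..n. p l)"
proof -
  have "(\<Sum>l = 1..<j. p l) + p j = (\<Sum>l = 1..<Suc j. p l)"
    using assms by simp
  also have "\<dots> \<le> (\<Sum>l = 1..n. p l)"
    using assms by (intro sum_mono2) auto
  finally show ?thesis .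
qed

lemma beta_block_append:
  assumes "\<theta> \<in> carrier_vec (\<Sum>l = 1..n. p l)" "j \<in> {1..n}"
  shows "beta_block p j (\<theta> @\<^sub>v w) = beta_block p j \<theta>"
  unfolding beta_block_def
  using assms(1) sum_block_le_sum[OF assms(2), of p]
  by (intro eq_vecI) (auto simp: append_vec_def)

text \<open>The offset of a block involves only the dimensions of earlier blocks. Induction can
  therefore append the next block at the end and leave the previous ones intact.\<close>

lemma ex_vec_beta_blocks:
  assumes "\<And>j. j \<in> {1..n} \<Longrightarrow> b j \<in> carrier_vec (p j)"
  shows "\<exists>\<theta>\<in>carrier_vec (\<Sum>l = 1..n. p l). \<forall>j\<in>{1..n}. beta_block p j \<theta> = b j"
  using assms
proof (induction n)
  case 0
  show ?case by (auto intro: zero_carrier_vec)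
next
  case (Suc n)
  then obtain \<theta> where \<theta>: "\<theta> \<in> carrier_vec (\<Sum>l = 1..n. p l)"
    and beta: "\<forall>j\<in>{1..n}. beta_block p j \<theta> = b j"
    by auto
  have b: "b (Suc n) \<in> carrier_vec (p (Suc n))"
    using Suc.prems by simp
  show ?case
  proof (intro bexI ballI)
    show "\<theta> @\<^sub>v b (Suc n) \<in> carrier_vec (\<Sum>l = 1..Suc n. p l)"
      using \<theta> b by simp
    fix j assume j: "j \<in> {1..Suc n}"
    show "beta_block p j (\<theta> @\<^sub>v b (Suc n)) = b j"
    proof (cases "j = Suc n")
      case True
      \<comment> \<open>The offset of block \<open>Suc n\<close> is a sum over
        \<open>{1..<Suc n}\<close>, which is exactly the length of \<theta>, so the block read is
        the appended vector.\<close>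
      then show ?thesis
        using \<theta> b
        by (intro eq_vecI) (auto simp: beta_block_def append_vec_def atLeastLessThanSuc_atLeastAtMost)
    next
      case False
      then have "j \<in> {1..n}" using j by auto
      then show ?thesis
        using beta_block_append[OF \<theta>] beta by simp
    qed
  qed
qed

text \<open>Lets a parameter be prescribed block by block, so that the reversed parameter can be
  built without arithmetic on vector indices.\<close>

lemma ex_param_blocks:
  assumes "\<And>j. j \<in> {1..J - 1} \<Longrightarrow> b j \<in> carrier_vec (p j)" "z \<in> carrier_vec pc"
  shows "\<exists>\<theta>\<in>carrier_vec (param_dim J p pc).
           (\<forall>j\<in>{1..J - 1}. beta_block p j \<theta> = b j) \<and> zeta_block J p pc \<theta> = z"
proof -
  obtain \<theta> where \<theta>: "\<theta> \<in> carrier_vec (\<Sum>l = 1..J - 1. p l)"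
    and beta: "\<forall>j\<in>{1..J - 1}. beta_block p j \<theta> = b j"
    using ex_vec_beta_blocks[where b = b, OF assms(1)] by blast
  show ?thesis
  proof (intro bexI conjI)
    show "\<theta> @\<^sub>v z \<in> carrier_vec (param_dim J p pc)"
      using \<theta> assms(2) by (simp add: param_dim_def)
    show "\<forall>j\<in>{1..J - 1}. beta_block p j (\<theta> @\<^sub>v z) = b j"
      using beta_block_append[OF \<theta>] beta by simp
    show "zeta_block J p pc (\<theta> @\<^sub>v z) = z"
      using \<theta> assms(2) by (intro eq_vecI) (auto simp: zeta_block_def append_vec_def)
  qed
qed

text \<open>Reversing the categories turns the lower sum at cut \<open>j\<close> into the upper sum
  at cut \<open>J - j\<close> and vice versa. The odds are inverted, hence the logits change
  sign.\<close>

lemma cumulative_ppo_probs_reverse: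
  assumes q: "cumulative_ppo_probs J p pc h hc \<theta> z q"
    and eta: "\<And>j. j \<in> {1..J - 1} \<Longrightarrow>
      h j z \<bullet> beta_block p j \<theta>' + hc z \<bullet> zeta_block J p pc \<theta>' =
      - (h (J - j) z \<bullet> beta_block p (J - j) \<theta> + hc z \<bullet> zeta_block J p pc \<theta>)"
  shows "cumulative_ppo_probs J p pc h hc \<theta>' z (restrict (\<lambda>j. q (J + 1 - j)) {1..J})"
    (is "cumulative_ppo_probs _ _ _ _ _ _ _ ?r")
proof -
  have pos: "q j > 0" if "j \<in> {1..J}" for j
    using q that by (simp add: cumulative_ppo_probs_def)
  have reindex: "(\<Sum>k = a..b. ?r k) = (\<Sum>k = J + 1 - b..J + 1 - a. q k)"
    if "1 \<le> a" "b \<le> J" for a b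
    using that
    by (intro sum.reindex_bij_witness[of _ "\<lambda>k. J + 1 - k" "\<lambda>k. J + 1 - k"]) auto
  show ?thesis
    unfolding cumulative_ppo_probs_def
  proof (intro conjI ballI)
    show "?r j > 0" if "j \<in> {1..J}" for j
      using that by (auto intro!: pos)
    show "(\<Sum>j = 1..J. ?r j) = 1"
      using reindex[of 1 J] q by (simp add: cumulative_ppo_probs_def)
    fix j assume j: "j \<in> {1..J - 1}"
    \<comment> \<open>These are the lower and upper sums of \<open>q\<close> at cut
      \<open>J - j\<close>. Both ranges are nonempty because \<open>j\<close> lies in
      \<open>{1..J - 1}\<close>, and positivity of both sums justifies splitting the logarithm of
      the quotient.\<close>
    define A B where "A = (\<Sum>k = 1..J - j. q k)" and "B = (\<Sum>k = J - j + 1..J. q k)"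
    have "A > 0" "B > 0"
      unfolding A_def B_def using j by (auto intro!: sum_pos pos)
    have jJ: "j \<le> J" "1 \<le> j + 1"
      using j by auto
    have idx: "J + 1 - 1 = J" "J + 1 - J = 1" "J + 1 - j = J - j + 1" "J + 1 - (j + 1) = J - j"
      using j by auto
    have "(\<Sum>k = 1..j. ?r k) = B" "(\<Sum>k = j + 1..J. ?r k) = A"
      using reindex[OF order_refl jJ(1)] reindex[OF jJ(2) order_refl]
      unfolding A_def B_def idx by (simp_all only:)
    moreover have "ln (B / A) = - ln (A / B)"
      using \<open>A > 0\<close> \<open>B > 0\<close> by (simp add: ln_div)
    moreover have "J - j \<in> {1..J - 1}"
      using j by auto
    then have "ln (A / B) =
        h (J - j) z \<bullet> beta_block p (J - j) \<theta> + hc z \<bullet> zeta_block J p pc \<theta>"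
      using q unfolding cumulative_ppo_probs_def A_def B_def by blast
    ultimately show "ln ((\<Sum>k = 1..j. ?r k) / (\<Sum>k = j + 1..J. ?r k)) =
        h j z \<bullet> beta_block p j \<theta>' + hc z \<bullet> zeta_block J p pc \<theta>'"
      using eta[OF j] by simp
  qed
qed

lemma ex_reversed_param:
  assumes "J \<ge> 2" and "m \<ge> 1"
    and x: "\<And>i. i \<in> {1..m} \<Longrightarrow> x i \<in> carrier_vec d"
    and h: "\<And>j. j \<in> {1..J - 1} \<Longrightarrow> h j \<in> carrier_vec d \<rightarrow> carrier_vec (p j)"
    and hc: "hc \<in> carrier_vec d \<rightarrow> carrier_vec pc"
    and sym: "\<And>i j. i \<in> {1..m} \<Longrightarrow> j \<in> {1..J - 1} \<Longrightarrow> h j (x i) = h (J - j) (x i)"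
    and \<theta>: "\<theta> \<in> param_space J m x p pc h"
  shows "\<exists>\<theta>'\<in>param_space J m x p pc h. \<forall>i\<in>{1..m}. \<forall>j\<in>{1..J}.
           cat_prob J p pc h hc x \<theta>' i j = cat_prob J p pc h hc x \<theta> i (J + 1 - j)"
proof -
  have hx: "h j (x i) \<in> carrier_vec (p j)" if "i \<in> {1..m}" "j \<in> {1..J - 1}" for i j
    using h[OF that(2)] x[OF that(1)] by auto
  \<comment> \<open>A single observation suffices: the common value
    \<open>h j (x 1) = h (J - j) (x 1)\<close> has only one dimension. This is what lets the negated
    block \<open>J - j\<close> fit into position \<open>j\<close>.\<close>
  have p: "p (J - j) = p j" if "j \<in> {1..J - 1}" for j
  proof -
    have "h j (x 1) \<in> carrier_vec (p j)" "h (J - j) (x 1) \<in> carrier_vec (p (J - j))"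
      using that \<open>m \<ge> 1\<close> by (auto intro!: hx)
    moreover have "h j (x 1) = h (J - j) (x 1)"
      using sym that \<open>m \<ge> 1\<close> by simp
    ultimately show ?thesis
      by (metis carrier_vecD)
  qed
  have beta_carrier: "beta_block p j \<theta> \<in> carrier_vec (p j)" for j
    by (simp add: beta_block_def)
  have zeta_carrier: "zeta_block J p pc \<theta> \<in> carrier_vec pc"
    by (simp add: zeta_block_def)
  have "- beta_block p (J - j) \<theta> \<in> carrier_vec (p j)" if "j \<in> {1..J - 1}" for j
    using beta_carrier[of "J - j"] p[OF that] by simp
  then obtain \<theta>' where \<theta>': "\<theta>' \<in> carrier_vec (param_dim J p pc)"
    and beta: "\<And>j. j \<in> {1..J - 1} \<Longrightarrow> beta_block p j \<theta>' = - beta_block p (J - j) \<theta>"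
    and zeta: "zeta_block J p pc \<theta>' = - zeta_block J p pc \<theta>"
    using ex_param_blocks[of J "\<lambda>j. - beta_block p (J - j) \<theta>" p "- zeta_block J p pc \<theta>" pc]
      zeta_carrier by auto
  have neg: "h j (x i) \<bullet> beta_block p j \<theta>' = - (h (J - j) (x i) \<bullet> beta_block p (J - j) \<theta>)"
    if "i \<in> {1..m}" "j \<in> {1..J - 1}" for i j
  proof -
    have "J - j \<in> {1..J - 1}" using that by auto
    then have "h (J - j) (x i) \<in> carrier_vec (p (J - j))"
      using hx that by blast
    then show ?thesis
      using beta_carrier[of "J - j"] by (simp add: beta[OF that(2)] sym[OF that])
  qed
  have feasible: "\<theta>' \<in> param_space J m x p pc h"
    unfolding param_space_def
  proof (intro CollectI conjI ballI)
    fix j i assume j: "j \<in> {1..J - 2}" and i: "i \<in> {1..m}"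
    have jJ: "j \<in> {1..J - 1}" "j + 1 \<in> {1..J - 1}"
      using j by auto
    \<comment> \<open>Reversal sends the neighbours \<open>j\<close>, \<open>j + 1\<close> to
      \<open>J - j\<close>, \<open>J - (j + 1)\<close>, and negation flips the inequality. The
      constraint for \<theta>' at \<open>j\<close> is thus the constraint for \<theta> at
      \<open>J - (j + 1)\<close>.\<close>
    have idx: "J - (j + 1) \<in> {1..J - 2}" "J - (j + 1) + 1 = J - j"
      using j by auto
    have "h (J - (j + 1)) (x i) \<bullet> beta_block p (J - (j + 1)) \<theta> <
        h (J - (j + 1) + 1) (x i) \<bullet> beta_block p (J - (j + 1) + 1) \<theta>"
      using \<theta> idx(1) i unfolding param_space_def by blast
    then show "h j (x i) \<bullet> beta_block p j \<theta>' < h (j + 1) (x i) \<bullet> beta_block p (j + 1) \<theta>'"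
      using neg[OF i jJ(1)] neg[OF i jJ(2)] unfolding idx(2) by simp
  qed (rule \<theta>')
  have "cat_prob J p pc h hc x \<theta>' i j = cat_prob J p pc h hc x \<theta> i (J + 1 - j)"
    if i: "i \<in> {1..m}" and j: "j \<in> {1..J}" for i j
  proof -
    define q where "q = cat_prob J p pc h hc x \<theta> i"
    have q: "cumulative_ppo_probs J p pc h hc \<theta> (x i) q"
      using theI'[OF cumulative_ppo_probs_ex1[OF \<open>J \<ge> 2\<close> \<theta> i, of hc]]
      unfolding q_def cat_prob_def by blast
    have "hc (x i) \<in> carrier_vec pc"
      using hc x[OF i] by auto
    then have "hc (x i) \<bullet> zeta_block J p pc \<theta>' = - (hc (x i) \<bullet> zeta_block J p pc \<theta>)"
      using zeta_carrier by (simp add: zeta)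
    then have "cumulative_ppo_probs J p pc h hc \<theta>' (x i)
        (restrict (\<lambda>j. q (J + 1 - j)) {1..J})"
      using neg[OF i] by (intro cumulative_ppo_probs_reverse[OF q]) simp
    \<comment> \<open>The restricted function is extensional and solves the model equations at the
      feasible \<theta>', so uniqueness identifies it with the value of
      \<open>cat_prob\<close>.\<close>
    then have "cat_prob J p pc h hc x \<theta>' i = restrict (\<lambda>j. q (J + 1 - j)) {1..J}"
      unfolding cat_prob_def
      by (intro the1_equality[OF cumulative_ppo_probs_ex1[OF \<open>J \<ge> 2\<close> feasible i]]) simp
    then show ?thesis
      using j by (simp add: q_def)
  qed
  with feasible show ?thesis
    by blast
qed

text \<open>Counts and probabilities are reversed together, so the inner sums over categories are
  merely summed backwards. The multinomial term in \<open>Y i j\<close> does not involve the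
  order.\<close>

lemma log_lik_reverse:
  assumes \<tau>: "\<And>j. j \<in> {1..J} \<Longrightarrow> \<tau> j = \<sigma> (J + 1 - j)"
    and prob: "\<And>i j. i \<in> {1..m} \<Longrightarrow> j \<in> {1..J} \<Longrightarrow> prob \<theta>' i j = prob \<theta> i (J + 1 - j)"
  shows "log_lik J m Y prob \<tau> \<theta>' = log_lik J m Y prob \<sigma> \<theta>"
proof -
  have rev: "(\<Sum>j = 1..J. f (J + 1 - j)) = (\<Sum>j = 1..J. f j)" for f :: "nat \<Rightarrow> real"
    using sum.atLeastAtMost_rev[of f 1 J] by simp
  have "(\<Sum>j = 1..J. ln (fact (Y i (\<tau> j)))) = (\<Sum>j = 1..J. ln (fact (Y i (\<sigma> j))) :: real)" for i
    using rev[of "\<lambda>j. ln (fact (Y i (\<sigma> j)))"] by (simp add: \<tau>)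
  moreover have "(\<Sum>j = 1..J. real (Y i (\<tau> j)) * ln (prob \<theta>' i j)) =
      (\<Sum>j = 1..J. real (Y i (\<sigma> j)) * ln (prob \<theta> i j))" if "i \<in> {1..m}" for i
    using rev[of "\<lambda>j. real (Y i (\<sigma> j)) * ln (prob \<theta> i j)"] that by (simp add: \<tau> prob)
  ultimately show ?thesis
    unfolding log_lik_def by simp
qed

theorem theorem2p3:
  fixes d J m pc :: nat
    and x :: "nat \<Rightarrow> real vec"
    and Y :: "nat \<Rightarrow> nat \<Rightarrow> nat"
    and p :: "nat \<Rightarrow> nat"
    and h :: "nat \<Rightarrow> real vec \<Rightarrow> real vec"
    and hc :: "real vec \<Rightarrow> real vec"
    and \<sigma>\<^sub>1 \<sigma>\<^sub>2 :: "nat \<Rightarrow> nat"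
  assumes "d \<ge> 1" and "J \<ge> 3"
    and "\<And>i. i \<in> {1..m} \<Longrightarrow> x i \<in> carrier_vec d"
    and "inj_on x {1..m}"
    and "\<And>i. i \<in> {1..m} \<Longrightarrow> (\<Sum>j = 1..J. Y i j) > 0"
    and "\<And>j. j \<in> {1..J - 1} \<Longrightarrow> h j \<in> carrier_vec d \<rightarrow> carrier_vec (p j)"
    and "hc \<in> carrier_vec d \<rightarrow> carrier_vec pc"
    and "\<And>i j. i \<in> {1..m} \<Longrightarrow> j \<in> {1..J - 1} \<Longrightarrow> h j (x i) = h (J - j) (x i)"
    and "\<sigma>\<^sub>1 permutes {1..J}" and "\<sigma>\<^sub>2 permutes {1..J}"
    and "\<And>j. j \<in> {1..J} \<Longrightarrow> \<sigma>\<^sub>2 j = \<sigma>\<^sub>1 (J + 1 - j)"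
  shows "equivalent_orders J m Y (param_space J m x p pc h) (cat_prob J p pc h hc x) \<sigma>\<^sub>1 \<sigma>\<^sub>2"
proof (cases "m = 0")
  case True
  then show ?thesis
    by (auto simp: equivalent_orders_def log_lik_def intro!: same_max_if_image_eq)
next
  case False
  let ?S = "param_space J m x p pc h"
  let ?L = "log_lik J m Y (cat_prob J p pc h hc x)"
  \<comment> \<open>Stated for arbitrary orders because it is used in both directions: reversal is
    an involution, so each of the two given orders is the reverse of the other.\<close>
  have subset: "?L \<sigma> ` ?S \<subseteq> ?L \<tau> ` ?S"
    if \<tau>: "\<And>j. j \<in> {1..J} \<Longrightarrow> \<tau> j = \<sigma> (J + 1 - j)" for \<sigma> \<tau>
  proof (rule image_subsetI)
    fix \<theta> assume \<theta>: "\<theta> \<in> ?S"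
    obtain \<theta>' where "\<theta>' \<in> ?S" and prob: "\<And>i j. i \<in> {1..m} \<Longrightarrow> j \<in> {1..J} \<Longrightarrow>
        cat_prob J p pc h hc x \<theta>' i j = cat_prob J p pc h hc x \<theta> i (J + 1 - j)"
      using ex_reversed_param[OF _ _ assms(3,6,7,8) \<theta>] False \<open>J \<ge> 3\<close> by auto
    moreover have "?L \<tau> \<theta>' = ?L \<sigma> \<theta>"
      by (intro log_lik_reverse \<tau> prob)
    ultimately show "?L \<sigma> \<theta> \<in> ?L \<tau> ` ?S"
      by (metis imageI)
  qed
  have "\<sigma>\<^sub>1 j = \<sigma>\<^sub>2 (J + 1 - j)" if "j \<in> {1..J}" for j
  proof -
    have "J + 1 - j \<in> {1..J}" "J + 1 - (J + 1 - j) = j"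
      using that by auto
    then show ?thesis
      using assms(11)[of "J + 1 - j"] by simp
  qed
  then show ?thesis
    unfolding equivalent_orders_def
    by (intro same_max_if_image_eq subset_antisym subset assms(11))
qed

end
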